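(* Let $n\ge4$ and let $S\in\{\mathcal{CT}_n,\mathcal{ORCT}_n,\mathcal{OCT}_n\}$. Then $S$ is not right abundant.
   Context: $[n]=\{1,\ldots,n\}$. $\mathcal{CT}_n$ is the semigroup, under composition (maps written on the right), of all $\alpha:[n]\to[n]$ with $|x\alpha-y\alpha|\le|x-y|$ for all $x,y$. $\mathcal{OCT}_n$ is its subsemigroup of order preserving maps ($x\le y\Rightarrow x\alpha\le y\alpha$), and $\mathcal{ORCT}_n$ its subsemigroup of maps that are order preserving or order reversing ($x\le y\Rightarrow x\alpha\ge y\alpha$). On a semigroup $S$, $a\,\mathcal R^*\,b$ means: for all $x,y\in S^1$, $xa=ya$ if and only if $xb=yb$. $S$ is right abundant if every $\mathcal R^*$-class of $S$ contains an idempotent. *)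

theory Defs
  imports Main "HOL-Library.FuncSet"
begin

text \<open>A semigroup is given by a carrier set \<open>S\<close> and a binary operation \<open>m\<close> on the ambient type.\<close>

definition semigroup_on :: "('a \<Rightarrow> 'a \<Rightarrow> 'a) \<Rightarrow> 'a set \<Rightarrow> bool" where
  "semigroup_on m S \<longleftrightarrow>
     (\<forall>a\<in>S. \<forall>b\<in>S. m a b \<in> S) \<and>
     (\<forall>a\<in>S. \<forall>b\<in>S. \<forall>c\<in>S. m (m a b) c = m a (m b c))"

definition has_identity :: "('a \<Rightarrow> 'a \<Rightarrow> 'a) \<Rightarrow> 'a set \<Rightarrow> bool" where
  "has_identity m S \<longleftrightarrow> (\<exists>e\<in>S. \<forall>a\<in>S. m e a = a \<and> m a e = a)"

text \<open>\<open>S\<^sup>1\<close> is \<open>S\<close> itself if \<open>S\<close> has an identity, and otherwise \<open>S\<close> with a new identity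
  (here \<open>None\<close>) adjoined.\<close>

definition adj_one :: "('a \<Rightarrow> 'a \<Rightarrow> 'a) \<Rightarrow> 'a set \<Rightarrow> 'a option set" where
  "adj_one m S = (if has_identity m S then Some ` S else insert None (Some ` S))"

fun mult_one :: "('a \<Rightarrow> 'a \<Rightarrow> 'a) \<Rightarrow> 'a option \<Rightarrow> 'a option \<Rightarrow> 'a option" where
  "mult_one m None y = y"
| "mult_one m (Some x) None = Some x"
| "mult_one m (Some x) (Some y) = Some (m x y)"

definition R_star :: "('a \<Rightarrow> 'a \<Rightarrow> 'a) \<Rightarrow> 'a set \<Rightarrow> ('a \<times> 'a) set" where
  "R_star m S = {(a, b). a \<in> S \<and> b \<in> S \<and>
     (\<forall>x\<in>adj_one m S. \<forall>y\<in>adj_one m S.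
        mult_one m x (Some a) = mult_one m y (Some a) \<longleftrightarrow>
        mult_one m x (Some b) = mult_one m y (Some b))}"

lemma equiv_R_star: "equiv S (R_star m S)"
  by (rule equivI) (auto simp: R_star_def refl_on_def sym_def trans_def)

definition right_abundant :: "('a \<Rightarrow> 'a \<Rightarrow> 'a) \<Rightarrow> 'a set \<Rightarrow> bool" where
  "right_abundant m S \<longleftrightarrow> (\<forall>C\<in>S // R_star m S. \<exists>e\<in>C. m e e = e)"

text \<open>Maps \<open>[n] \<rightarrow> [n]\<close> are extensional functions on \<open>{1..n}\<close>, so that equality of functions is
  equality of maps. Maps are written on the right: in the product \<open>\<alpha>\<beta>\<close> the map \<open>\<alpha>\<close>
  is applied first.\<close>

definition comp_right :: "nat \<Rightarrow> (nat \<Rightarrow> nat) \<Rightarrow> (nat \<Rightarrow> nat) \<Rightarrow> (nat \<Rightarrow> nat)" where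
  "comp_right n \<alpha> \<beta> = compose {1..n} \<beta> \<alpha>"

definition CT :: "nat \<Rightarrow> (nat \<Rightarrow> nat) set" where
  "CT n = {\<alpha> \<in> {1..n} \<rightarrow>\<^sub>E {1..n}.
     \<forall>x\<in>{1..n}. \<forall>y\<in>{1..n}. \<bar>int (\<alpha> x) - int (\<alpha> y)\<bar> \<le> \<bar>int x - int y\<bar>}"

definition OCT :: "nat \<Rightarrow> (nat \<Rightarrow> nat) set" where
  "OCT n = {\<alpha> \<in> CT n. monotone_on {1..n} (\<le>) (\<le>) \<alpha>}"

definition ORCT :: "nat \<Rightarrow> (nat \<Rightarrow> nat) set" where
  "ORCT n = {\<alpha> \<in> CT n. monotone_on {1..n} (\<le>) (\<le>) \<alpha> \<or> monotone_on {1..n} (\<le>) (\<ge>) \<alpha>}"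

lemma CT_in: "\<alpha> \<in> CT n \<Longrightarrow> x \<in> {1..n} \<Longrightarrow> \<alpha> x \<in> {1..n}"
  unfolding CT_def by blast

lemma comp_right_apply: "x \<in> {1..n} \<Longrightarrow> comp_right n \<alpha> \<beta> x = \<beta> (\<alpha> x)"
  by (simp add: comp_right_def compose_def)

lemma comp_right_assoc:
  assumes "\<alpha> \<in> CT n"
  shows "comp_right n (comp_right n \<alpha> \<beta>) \<gamma> = comp_right n \<alpha> (comp_right n \<beta> \<gamma>)"
proof
  fix x
  show "comp_right n (comp_right n \<alpha> \<beta>) \<gamma> x = comp_right n \<alpha> (comp_right n \<beta> \<gamma>) x"
    using CT_in[OF assms, of x]
    by (cases "x \<in> {1..n}") (auto simp: comp_right_def compose_def)
qed

lemma comp_right_CT: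
  assumes a: "\<alpha> \<in> CT n" and b: "\<beta> \<in> CT n"
  shows "comp_right n \<alpha> \<beta> \<in> CT n"
proof -
  have "comp_right n \<alpha> \<beta> \<in> {1..n} \<rightarrow>\<^sub>E {1..n}"
    using CT_in[OF b CT_in[OF a]] unfolding comp_right_def compose_def PiE_def
    by (auto simp: extensional_def)
  moreover have "\<bar>int (comp_right n \<alpha> \<beta> x) - int (comp_right n \<alpha> \<beta> y)\<bar> \<le> \<bar>int x - int y\<bar>"
    if x: "x \<in> {1..n}" and y: "y \<in> {1..n}" for x y
  proof -
    have "\<bar>int (\<beta> (\<alpha> x)) - int (\<beta> (\<alpha> y))\<bar> \<le> \<bar>int (\<alpha> x) - int (\<alpha> y)\<bar>"
      using b CT_in[OF a x] CT_in[OF a y] unfolding CT_def by blast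
    also have "\<dots> \<le> \<bar>int x - int y\<bar>"
      using a x y unfolding CT_def by blast
    finally show ?thesis using x y by (simp only: comp_right_apply)
  qed
  ultimately show ?thesis unfolding CT_def by blast
qed

lemma semigroup_CT: "semigroup_on (comp_right n) (CT n)"
  unfolding semigroup_on_def by (blast intro: comp_right_CT comp_right_assoc)

lemma monotone_comp_right:
  assumes "\<alpha> \<in> CT n" "monotone_on {1..n} (\<le>) P \<alpha>" "monotone_on {1..n} P Q \<beta>"
  shows "monotone_on {1..n} (\<le>) Q (comp_right n \<alpha> \<beta>)"
proof (rule monotone_onI)
  fix x y assume x: "x \<in> {1..n}" and y: "y \<in> {1..n}" and "x \<le> y"
  then have "P (\<alpha> x) (\<alpha> y)" by (rule monotone_onD[OF assms(2)])
  then have "Q (\<beta> (\<alpha> x)) (\<beta> (\<alpha> y))"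
    by (rule monotone_onD[OF assms(3) CT_in[OF assms(1) x] CT_in[OF assms(1) y]])
  then show "Q (comp_right n \<alpha> \<beta> x) (comp_right n \<alpha> \<beta> y)"
    by (simp only: comp_right_apply[OF x] comp_right_apply[OF y])
qed

lemma semigroup_OCT: "semigroup_on (comp_right n) (OCT n)"
  unfolding semigroup_on_def OCT_def
  by (blast intro: comp_right_CT comp_right_assoc monotone_comp_right)

lemma semigroup_ORCT: "semigroup_on (comp_right n) (ORCT n)"
proof -
  have flip: "monotone_on {1..n} (\<ge>) (\<ge>) \<beta>" if "monotone_on {1..n} (\<le>) (\<le>) \<beta>"
    for \<beta> :: "nat \<Rightarrow> nat"
    using that unfolding monotone_on_def by blast
  have flip': "monotone_on {1..n} (\<ge>) (\<le>) \<beta>" if "monotone_on {1..n} (\<le>) (\<ge>) \<beta>"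
    for \<beta> :: "nat \<Rightarrow> nat"
    using that unfolding monotone_on_def by blast
  have closed: "comp_right n \<alpha> \<beta> \<in> ORCT n" if "\<alpha> \<in> ORCT n" "\<beta> \<in> ORCT n" for \<alpha> \<beta>
  proof -
    have c: "\<alpha> \<in> CT n" "\<beta> \<in> CT n"
      and a: "monotone_on {1..n} (\<le>) (\<le>) \<alpha> \<or> monotone_on {1..n} (\<le>) (\<ge>) \<alpha>"
      and b: "monotone_on {1..n} (\<le>) (\<le>) \<beta> \<or> monotone_on {1..n} (\<le>) (\<ge>) \<beta>"
      using that unfolding ORCT_def by blast+
    from a b have "monotone_on {1..n} (\<le>) (\<le>) (comp_right n \<alpha> \<beta>) \<or>
        monotone_on {1..n} (\<le>) (\<ge>) (comp_right n \<alpha> \<beta>)"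
      using monotone_comp_right[OF c(1)] flip[of \<beta>] flip'[of \<beta>] by meson
    with comp_right_CT[OF c] show ?thesis unfolding ORCT_def by blast
  qed
  moreover have "\<alpha> \<in> CT n" if "\<alpha> \<in> ORCT n" for \<alpha>
    using that unfolding ORCT_def by blast
  ultimately show ?thesis unfolding semigroup_on_def
    by (blast intro: comp_right_assoc)
qed

end

theory Submission
  imports Defs
begin

text \<open>Multiplying constant maps by \<open>\<alpha>\<close> recovers its values, so
  \<open>\<R>\<^sup>*\<close>-related maps have the same kernel. Take \<open>\<alpha>\<close> with kernel classes
  \<open>{1}\<close>, \<open>{2, 3}\<close>, \<open>{4, \<dots>, n}\<close>. An idempotent contraction \<open>\<epsilon>\<close> maps
  every point into its own kernel class, so with this kernel it would fix 1, and also 4 because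
  it cannot increase the distance from 1; then \<open>2\<epsilon> = 3\<epsilon>\<close> would be
  at distance at most 1 from both 1 and 4.\<close>

lemma OCT_subset_CT: "OCT n \<subseteq> CT n"
  by (auto simp: OCT_def)

lemma OCT_subset_ORCT: "OCT n \<subseteq> ORCT n"
  by (auto simp: OCT_def ORCT_def)

lemma ORCT_subset_CT: "ORCT n \<subseteq> CT n"
  by (auto simp: ORCT_def)

lemma const_in_OCT: "i \<in> {1..n} \<Longrightarrow> (\<lambda>x\<in>{1..n}. i) \<in> OCT n"
  by (auto simp: OCT_def CT_def monotone_on_def)

text \<open>On \<open>{1..n}\<close> the products are constant with values \<open>\<alpha> i\<close>
  and \<open>\<alpha> j\<close>; the point \<open>i\<close> serves to compare them.\<close>

lemma const_comp_right_eq_iff: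
  assumes "i \<in> {1..n}" "j \<in> {1..n}"
  shows "comp_right n (\<lambda>x\<in>{1..n}. i) \<alpha> = comp_right n (\<lambda>x\<in>{1..n}. j) \<alpha> \<longleftrightarrow> \<alpha> i = \<alpha> j"
proof
  assume "comp_right n (\<lambda>x\<in>{1..n}. i) \<alpha> = comp_right n (\<lambda>x\<in>{1..n}. j) \<alpha>"
  then have "comp_right n (\<lambda>x\<in>{1..n}. i) \<alpha> i = comp_right n (\<lambda>x\<in>{1..n}. j) \<alpha> i"
    by (rule fun_cong)
  then show "\<alpha> i = \<alpha> j"
    using assms by (simp add: comp_right_apply del: atLeastAtMost_iff)
qed (auto simp: comp_right_def compose_def)

text \<open>The constant maps with values \<open>i\<close> and \<open>j\<close> are the two left
  multipliers. They already lie in \<open>OCT n\<close>, so one argument covers all three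
  semigroups.\<close>

lemma R_star_imp_same_kernel:
  assumes "OCT n \<subseteq> S" and "(\<alpha>, \<beta>) \<in> R_star (comp_right n) S"
    and "i \<in> {1..n}" "j \<in> {1..n}"
  shows "\<alpha> i = \<alpha> j \<longleftrightarrow> \<beta> i = \<beta> j"
proof -
  have "Some (\<lambda>x\<in>{1..n}. k) \<in> adj_one (comp_right n) S" if "k \<in> {1..n}" for k
    using const_in_OCT[OF that] assms(1) by (auto simp: adj_one_def)
  then have "mult_one (comp_right n) (Some (\<lambda>x\<in>{1..n}. i)) (Some \<alpha>)
        = mult_one (comp_right n) (Some (\<lambda>x\<in>{1..n}. j)) (Some \<alpha>) \<longleftrightarrow>
      mult_one (comp_right n) (Some (\<lambda>x\<in>{1..n}. i)) (Some \<beta>)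
        = mult_one (comp_right n) (Some (\<lambda>x\<in>{1..n}. j)) (Some \<beta>)"
    using assms(2-4) unfolding R_star_def by blast
  then show ?thesis
    by (simp only: mult_one.simps option.inject const_comp_right_eq_iff[OF assms(3,4)])
qed

lemma CT_contraction:
  "\<alpha> \<in> CT n \<Longrightarrow> x \<in> {1..n} \<Longrightarrow> y \<in> {1..n} \<Longrightarrow>
    \<bar>int (\<alpha> x) - int (\<alpha> y)\<bar> \<le> \<bar>int x - int y\<bar>"
  unfolding CT_def by blast

theorem lemma1p20:
  fixes n :: nat and S :: "(nat \<Rightarrow> nat) set"
  assumes "n \<ge> 4" and "S \<in> {CT n, ORCT n, OCT n}"
  shows "\<not> right_abundant (comp_right n) S"
proof
  assume abundant: "right_abundant (comp_right n) S"
  have OCT_S: "OCT n \<subseteq> S" and S_CT: "S \<subseteq> CT n"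
    using assms(2) OCT_subset_CT OCT_subset_ORCT ORCT_subset_CT by blast+
  define \<alpha> :: "nat \<Rightarrow> nat"
    \<comment> \<open>The values 1, 2, 2, 3, 3, ... rise by at most 1 per step, so this is an order
      preserving contraction.\<close>
    where "\<alpha> = (\<lambda>x\<in>{1..n}. if x = 1 then 1 else if x \<le> 3 then 2 else 3)"
  have "\<alpha> \<in> OCT n"
    using assms(1) by (auto simp: \<alpha>_def OCT_def CT_def monotone_on_def)
  then have "R_star (comp_right n) S `` {\<alpha>} \<in> S // R_star (comp_right n) S"
    using OCT_S by (blast intro: quotientI)
  then obtain \<epsilon> where rel: "(\<alpha>, \<epsilon>) \<in> R_star (comp_right n) S"
    and idem: "comp_right n \<epsilon> \<epsilon> = \<epsilon>"
    using abundant unfolding right_abundant_def by blast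
  have \<epsilon>: "\<epsilon> \<in> CT n"
    using rel S_CT by (auto simp: R_star_def)
  \<comment> \<open>Idempotency says that \<open>\<epsilon>\<close> takes the same value at
    \<open>\<epsilon> x\<close> and at \<open>x\<close>; the common kernel transfers this to
    \<open>\<alpha>\<close>.\<close>
  have same_class: "\<alpha> (\<epsilon> x) = \<alpha> x" if "x \<in> {1..n}" for x
    using R_star_imp_same_kernel[OF OCT_S rel CT_in[OF \<epsilon> that] that]
      comp_right_apply[OF that, of \<epsilon> \<epsilon>] idem by simp
  have mem: "1 \<in> {1..n}" "2 \<in> {1..n}" "3 \<in> {1..n}" "4 \<in> {1..n}"
    using assms(1) by auto
  have \<alpha>_apply: "\<alpha> y = (if y = 1 then 1 else if y \<le> 3 then 2 else 3)" if "y \<in> {1..n}" for y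
    unfolding \<alpha>_def using that by (rule restrict_apply')
  have \<alpha>_1: "y = 1" if "\<alpha> y = \<alpha> 1" "y \<in> {1..n}" for y
    using that(1) unfolding \<alpha>_apply[OF that(2)] \<alpha>_apply[OF mem(1)] by presburger
  have \<alpha>_4: "4 \<le> y" if "\<alpha> y = \<alpha> 4" "y \<in> {1..n}" for y
    using that(1) unfolding \<alpha>_apply[OF that(2)] \<alpha>_apply[OF mem(4)] by presburger
  have "\<epsilon> 1 = 1"
    using same_class[OF mem(1)] CT_in[OF \<epsilon> mem(1)] by (rule \<alpha>_1)
  moreover have "4 \<le> \<epsilon> 4"
    using same_class[OF mem(4)] CT_in[OF \<epsilon> mem(4)] by (rule \<alpha>_4)
  moreover have "\<epsilon> 2 = \<epsilon> 3"
    using R_star_imp_same_kernel[OF OCT_S rel mem(2,3)] \<alpha>_apply[OF mem(2)] \<alpha>_apply[OF mem(3)] by simp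
  \<comment> \<open>Contraction on the pairs 1, 2 and 3, 4 gives \<open>\<epsilon> 2 \<le> 2\<close>
    and \<open>\<epsilon> 3 \<ge> 3\<close>, so the lower bound on \<open>\<epsilon> 4\<close>
    suffices.\<close>
  ultimately show False
    using CT_contraction[OF \<epsilon> mem(1,2)] CT_contraction[OF \<epsilon> mem(3,4)] by simp
qed

end
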